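(* Let $\digamma$ be a holomorphic correspondence on the Riemann sphere $\widehat{\mathbb{C}}$ and let $U$ be an open subset of $\widehat{\mathbb{C}}$. Then the image set $\digamma(U)$ is also open in $\widehat{\mathbb{C}}$.
   Context: Let $\pi_1,\pi_2$ be the coordinate projections of $\widehat{\mathbb{C}}\times\widehat{\mathbb{C}}$. A holomorphic correspondence on $\widehat{\mathbb{C}}$ is a formal sum $\Gamma=\sum_{j=1}^{N}\Gamma_j$ of (not necessarily distinct) irreducible complex subvarieties $\Gamma_j$ of $\widehat{\mathbb{C}}\times\widehat{\mathbb{C}}$ of dimension $1$ such that for each $1\le j\le N$ both $\pi_1|_{\Gamma_j}$ and $\pi_2|_{\Gamma_j}$ are surjective, and for every $z_0\in\widehat{\mathbb{C}}$ the sets $\bigcup_j\pi_1^{-1}\{z_0\}\cap\Gamma_j$ and $\bigcup_j\pi_2^{-1}\{z_0\}\cap\Gamma_j$ (points repeated according to multiplicity) are finite. The set-valued map induced by $\Gamma$ is denoted $\digamma$, and the image of $A\subseteq\widehat{\mathbb{C}}$ is $\digamma(A):=\bigcup_{j=1}^{N}\pi_2\big(\pi_1^{-1}(A)\cap\Gamma_j\big)$. *)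

theory Defs
  imports "HOL-Complex_Analysis.Complex_Analysis"
begin

section \<open>The Riemann sphere\<close>

text \<open>The point at infinity is \<^term>\<open>None\<close>.\<close>

type_synonym riemann_sphere = "complex option"

definition sphere_topology :: "riemann_sphere topology" where
  "sphere_topology = Alexandroff_compactification euclidean"

definition coord_at_infinity :: "complex \<Rightarrow> riemann_sphere" where
  "coord_at_infinity z = (if z = 0 then None else Some (inverse z))"

text \<open>
  The complex structure is given by the inverses of the two standard charts: each of the following
  maps parametrizes an open subset of the sphere by the whole plane. Products of two of them
  parametrize the four affine charts covering the product of two spheres.
\<close>

definition sphere_params :: "(complex \<Rightarrow> riemann_sphere) set" where
  "sphere_params = {Some, coord_at_infinity}"

section \<open>Holomorphic functions of two variables\<close>

text \<open>Complex differentiability at each point; only meant for open \<open>V\<close>.\<close>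

definition holomorphic2_on :: "(complex \<times> complex \<Rightarrow> complex) \<Rightarrow> (complex \<times> complex) set \<Rightarrow> bool" where
  "holomorphic2_on f V \<longleftrightarrow>
     (\<forall>p\<in>V. \<exists>a b. (f has_derivative (\<lambda>(h, k). a * h + b * k)) (at p))"

definition biholomorphic2 ::
  "(complex \<times> complex) set \<Rightarrow> (complex \<times> complex) set \<Rightarrow>
   (complex \<times> complex \<Rightarrow> complex \<times> complex) \<Rightarrow> (complex \<times> complex \<Rightarrow> complex \<times> complex) \<Rightarrow> bool" where
  "biholomorphic2 V W \<Phi> \<Psi> \<longleftrightarrow>
     open V \<and> open W \<and> homeomorphism V W \<Phi> \<Psi> \<and>
     holomorphic2_on (fst \<circ> \<Phi>) V \<and> holomorphic2_on (snd \<circ> \<Phi>) V \<and>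
     holomorphic2_on (fst \<circ> \<Psi>) W \<and> holomorphic2_on (snd \<circ> \<Psi>) W"

section \<open>Complex subvarieties of the product of two spheres\<close>

text \<open>
  Every point of the plane, not only of \<open>S\<close>, has a neighbourhood in which \<open>S\<close> is the common zero
  set of finitely many holomorphic functions; in particular \<open>S\<close> is closed.
\<close>

definition analytic_subset_C2 :: "(complex \<times> complex) set \<Rightarrow> bool" where
  "analytic_subset_C2 S \<longleftrightarrow>
     (\<forall>p. \<exists>V F. open V \<and> p \<in> V \<and> finite F \<and> (\<forall>f\<in>F. holomorphic2_on f V) \<and>
        S \<inter> V = {x \<in> V. \<forall>f\<in>F. f x = 0})"

definition subvariety :: "(riemann_sphere \<times> riemann_sphere) set \<Rightarrow> bool" where
  "subvariety A \<longleftrightarrow>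
     (\<forall>\<phi>\<in>sphere_params. \<forall>\<psi>\<in>sphere_params. analytic_subset_C2 (map_prod \<phi> \<psi> -` A))"

definition irreducible_subvariety :: "(riemann_sphere \<times> riemann_sphere) set \<Rightarrow> bool" where
  "irreducible_subvariety A \<longleftrightarrow>
     subvariety A \<and> A \<noteq> {} \<and>
     (\<forall>B C. subvariety B \<and> subvariety C \<and> A = B \<union> C \<longrightarrow> A = B \<or> A = C)"

text \<open>The span of the first \<open>d\<close> coordinate vectors, for \<open>d \<le> 2\<close>.\<close>

definition coordinate_plane :: "nat \<Rightarrow> (complex \<times> complex) set" where
  "coordinate_plane d = {(u, v). (d < 1 \<longrightarrow> u = 0) \<and> (d < 2 \<longrightarrow> v = 0)}"

text \<open>Near \<open>p\<close>, the set \<open>S\<close> is a complex submanifold of dimension \<open>d\<close>.\<close>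

definition regular_point_C2 :: "nat \<Rightarrow> (complex \<times> complex) set \<Rightarrow> complex \<times> complex \<Rightarrow> bool" where
  "regular_point_C2 d S p \<longleftrightarrow>
     p \<in> S \<and> (\<exists>V W \<Phi> \<Psi>. biholomorphic2 V W \<Phi> \<Psi> \<and> p \<in> V \<and>
                \<Phi> ` (S \<inter> V) = W \<inter> coordinate_plane d)"

text \<open>
  The dimension of a nonempty analytic set is the largest dimension of the submanifold formed by it
  near one of its regular points.
\<close>

definition subvariety_dim :: "(riemann_sphere \<times> riemann_sphere) set \<Rightarrow> nat" where
  "subvariety_dim A =
     Max {d. d \<le> 2 \<and> (\<exists>\<phi>\<in>sphere_params. \<exists>\<psi>\<in>sphere_params. \<exists>p.
                         regular_point_C2 d (map_prod \<phi> \<psi> -` A) p)}"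

section \<open>Holomorphic correspondences\<close>

text \<open>
  The formal sum of \<open>\<Gamma> 1, \<dots>, \<Gamma> N\<close> is given by \<open>N\<close> and the family \<open>\<Gamma>\<close>, whose members may coincide;
  values of \<open>\<Gamma>\<close> outside \<open>{1..N}\<close> are irrelevant. The fibres are disjoint unions over the index,
  so that a point is repeated once for each \<open>\<Gamma> j\<close> containing it.
\<close>

definition holomorphic_correspondence ::
  "nat \<Rightarrow> (nat \<Rightarrow> (riemann_sphere \<times> riemann_sphere) set) \<Rightarrow> bool" where
  "holomorphic_correspondence N \<Gamma> \<longleftrightarrow>
     1 \<le> N \<and>
     (\<forall>j\<in>{1..N}. irreducible_subvariety (\<Gamma> j) \<and> subvariety_dim (\<Gamma> j) = 1 \<and>
        fst ` \<Gamma> j = UNIV \<and> snd ` \<Gamma> j = UNIV) \<and>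
     (\<forall>z\<^sub>0. finite (SIGMA j:{1..N}. fst -` {z\<^sub>0} \<inter> \<Gamma> j) \<and>
            finite (SIGMA j:{1..N}. snd -` {z\<^sub>0} \<inter> \<Gamma> j))"

definition correspondence_image ::
  "nat \<Rightarrow> (nat \<Rightarrow> (riemann_sphere \<times> riemann_sphere) set) \<Rightarrow> riemann_sphere set \<Rightarrow> riemann_sphere set" where
  "correspondence_image N \<Gamma> A = (\<Union>j\<in>{1..N}. snd ` (fst -` A \<inter> \<Gamma> j))"

end

(* Fix a point (a, b) of a branch, in affine charts. Since the fibre over b is finite, one of the local
   equations, f say, has an isolated zero at a on the slice w = b. Its zeros near a then move
   continuously with w, and for any other holomorphic g the product R(w) of the values of g over these
   zeros is holomorphic: the argument principle makes the power sums of the values holomorphic, and Newton's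
   identities express R through them. Irreducibility excludes isolated points, so (a, b) is a limit
   of points of the branch with w different from b, at which R vanishes; hence R vanishes identically.
   Taking for g the combinations sum_i t^i g_i of the local equations, for infinitely many t, shows that
   every w near b lies below a common zero. *)
theory Submission
  imports Defs
begin

section \<open>Newton's identities\<close>

text \<open>Logarithmic differentiation: the factor belonging to \<open>z\<close> contributes
  \<open>- m z * v z / (1 - v z * X)\<close>, and the geometric series expands this into powers of
  \<open>v z\<close>. Multiplying through by \<open>E A\<close> avoids dividing power
  series.\<close>

lemma fps_deriv_prod_linear_powers:
  fixes v :: "'a \<Rightarrow> 'b::field_char_0" and m :: "'a \<Rightarrow> nat"
  assumes "finite A"
  defines "E \<equiv> \<lambda>A. \<Prod>z\<in>A. (1 - fps_const (v z) * fps_X) ^ m z"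
  shows "fps_deriv (E A) = - (E A * Abs_fps (\<lambda>n. \<Sum>z\<in>A. of_nat (m z) * v z ^ Suc n))"
  using assms(1)
proof (induction A rule: finite_induct)
  case empty
  then show ?case by (simp add: E_def fps_eq_iff)
next
  case (insert x A)
  define L where "L = 1 - fps_const (v x) * fps_X"
  define G where "G = Abs_fps (\<lambda>n. v x ^ n)"
  define P where "P = Abs_fps (\<lambda>n. \<Sum>z\<in>A. of_nat (m z) * v z ^ Suc n)"
  have LG: "L * G = 1"
  proof (rule fps_ext)
    fix n
    show "(L * G) $ n = 1 $ n"
      by (cases n) (simp_all add: L_def G_def left_diff_distrib mult.assoc)
  qed
  have E: "E (insert x A) = L ^ m x * E A"
    using insert by (simp add: E_def L_def)
  have dL: "fps_deriv (L ^ m x) = - (fps_const (of_nat (m x) * v x) * G * L ^ m x)"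
  proof (cases "m x")
    case 0
    then show ?thesis by simp
  next
    case (Suc k)
    have dL1: "fps_deriv L = - fps_const (v x)" by (simp add: L_def)
    have "fps_deriv (L ^ m x) = fps_const (of_nat (Suc k)) * - fps_const (v x) * L ^ k"
      unfolding Suc fps_deriv_power dL1 by (simp only: diff_Suc_1 fps_of_nat)
    also have "fps_const (of_nat (Suc k)) * - fps_const (v x) = - fps_const (of_nat (m x) * v x)"
      unfolding Suc mult_minus_right fps_const_mult ..
    also have "- fps_const (of_nat (m x) * v x) * L ^ k = - (fps_const (of_nat (m x) * v x) * L ^ k)"
      by (rule mult_minus_left)
    also have "L ^ k = G * L ^ m x"
      using LG by (simp add: Suc mult.assoc[symmetric] mult.commute)
    finally show ?thesis by (simp add: mult.assoc)
  qed
  have P: "Abs_fps (\<lambda>n. \<Sum>z\<in>insert x A. of_nat (m z) * v z ^ Suc n)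
          = fps_const (of_nat (m x) * v x) * G + P"
    using insert by (intro fps_ext) (simp add: P_def G_def)
  show ?case
    unfolding E P using insert.IH unfolding P_def[symmetric]
    by (simp add: dL algebra_simps)
qed

text \<open>Coefficient \<open>n\<close> of the logarithmic derivative identity. Up to sign, the
  coefficients of \<open>q\<close> are the elementary symmetric functions of the \<open>v z\<close>,
  each repeated \<open>m z\<close> times.\<close>

lemma newton_identity:
  fixes v :: "'a \<Rightarrow> 'b::field_char_0" and m :: "'a \<Rightarrow> nat"
  assumes "finite A"
  defines "q \<equiv> \<Prod>z\<in>A. [:1, - v z:] ^ m z"
  shows "of_nat (Suc n) * coeff q (Suc n)
           = - (\<Sum>i\<le>n. coeff q i * (\<Sum>z\<in>A. of_nat (m z) * v z ^ Suc (n - i)))"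
proof -
  define E where "E = (\<Prod>z\<in>A. (1 - fps_const (v z) * fps_X) ^ m z)"
  have "fps_of_poly q = E"
    unfolding q_def E_def by (simp add: fps_of_poly_prod fps_of_poly_power fps_of_poly_linear'
        flip: fps_const_neg)
  then have c: "coeff q i = E $ i" for i by auto
  have "fps_deriv E $ n = - (\<Sum>i=0..n. E $ i * (\<Sum>z\<in>A. of_nat (m z) * v z ^ Suc (n - i)))"
    using fps_deriv_prod_linear_powers[OF assms(1), of v m]
    unfolding E_def[symmetric] by (simp add: fps_mult_nth)
  then show ?thesis by (simp add: c atLeast0AtMost)
qed

text \<open>Single points of \<open>Z w\<close> need not depend holomorphically on \<open>w\<close>;
  only symmetric expressions do. Newton's identities turn holomorphic power sums into holomorphic
  coefficients, and the common bound \<open>K\<close> lets finitely many of them recover the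
  product.\<close>

lemma holomorphic_on_weighted_product:
  fixes v :: "complex \<Rightarrow> 'a \<Rightarrow> complex" and m :: "complex \<Rightarrow> 'a \<Rightarrow> nat"
  assumes fin: "\<And>w. w \<in> D \<Longrightarrow> finite (Z w)"
    and bound: "\<And>w. w \<in> D \<Longrightarrow> (\<Sum>z\<in>Z w. m w z) \<le> K"
    and hol: "\<And>n. (\<lambda>w. \<Sum>z\<in>Z w. of_nat (m w z) * (1 - v w z) ^ n) holomorphic_on D"
  shows "(\<lambda>w. \<Prod>z\<in>Z w. v w z ^ m w z) holomorphic_on D"
proof -
  \<comment> \<open>With \<open>1 - v\<close> in place of \<open>v\<close> the product is a value of \<open>q\<close>, not a coefficient of varying index.\<close>
  define q where "q w = (\<Prod>z\<in>Z w. [:1, - (1 - v w z):] ^ m w z)" for w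
  \<comment> \<open>Coefficient \<open>0\<close> is constantly \<open>1\<close>; coefficient
    \<open>Suc k\<close> comes from Newton's identity after division by
    \<open>Suc k\<close>.\<close>
  have hol_coeff: "(\<lambda>w. coeff (q w) n) holomorphic_on D" for n
  proof (induction n rule: less_induct)
    case (less n)
    show ?case
    proof (cases n)
      case 0
      then show ?thesis by (simp add: q_def poly_0_coeff_0[symmetric] poly_prod)
    next
      case (Suc k)
      have "(\<lambda>w. - (\<Sum>i\<le>k. coeff (q w) i * (\<Sum>z\<in>Z w. of_nat (m w z) * (1 - v w z) ^ Suc (k - i))) 
              / of_nat (Suc k)) holomorphic_on D"
        using Suc by (intro holomorphic_intros less hol) auto
      then show ?thesis
      proof (rule holomorphic_transform)
        fix w assume "w \<in> D"
        from newton_identity[OF fin[OF this], where v = "\<lambda>z. 1 - v w z" and m = "m w" and n = k]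
        show "- (\<Sum>i\<le>k. coeff (q w) i * (\<Sum>z\<in>Z w. of_nat (m w z) * (1 - v w z) ^ Suc (k - i))) 
              / of_nat (Suc k) = coeff (q w) n"
          unfolding q_def[symmetric] Suc
          by (metis nonzero_mult_div_cancel_left of_nat_eq_0_iff old.nat.distinct(2))
      qed
    qed
  qed
  have "(\<lambda>w. \<Sum>n\<le>K. coeff (q w) n) holomorphic_on D"
    by (intro holomorphic_intros hol_coeff)
  then show ?thesis
  proof (rule holomorphic_transform)
    fix w assume w: "w \<in> D"
    have "degree (q w) \<le> (\<Sum>z\<in>Z w. degree ([:1, - (1 - v w z):] ^ m w z))"
      unfolding q_def using degree_prod_sum_le[OF fin[OF w]] by (simp add: o_def)
    also have "\<dots> \<le> (\<Sum>z\<in>Z w. m w z)"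
    proof (rule sum_mono)
      fix z
      have "degree ([:1, - (1 - v w z):] ^ m w z) \<le> degree [:1, - (1 - v w z):] * m w z"
        by (rule degree_power_le)
      also have "\<dots> \<le> 1 * m w z"
        by (intro mult_right_mono) auto
      finally show "degree ([:1, - (1 - v w z):] ^ m w z) \<le> m w z" by simp
    qed
    finally have deg: "degree (q w) \<le> K" using bound[OF w] by simp
    \<comment> \<open>Coefficients beyond the degree vanish, so the sum up to \<open>K\<close>
      evaluates \<open>q w\<close> at \<open>1\<close>, where each linear factor becomes
      \<open>v w z\<close>.\<close>
    have "(\<Sum>n\<le>K. coeff (q w) n) = poly (q w) 1"
      unfolding poly_altdef using deg
      by (simp, intro sum.mono_neutral_right) (auto simp: coeff_eq_0)
    also have "\<dots> = (\<Prod>z\<in>Z w. v w z ^ m w z)"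
      by (simp add: q_def poly_prod)
    finally show "(\<Sum>n\<le>K. coeff (q w) n) = (\<Prod>z\<in>Z w. v w z ^ m w z)" .
  qed
qed

section \<open>Contour integrals with a holomorphic parameter\<close>

lemma continuous_on_contour_integral_param:
  fixes f :: "'a::topological_space \<Rightarrow> complex \<Rightarrow> complex"
  assumes "path \<gamma>" and dg: "continuous_on {0..1} (\<lambda>t. vector_derivative \<gamma> (at t))"
    and f: "continuous_on (S \<times> path_image \<gamma>) (\<lambda>(x, z). f x z)"
  shows "continuous_on S (\<lambda>x. contour_integral \<gamma> (f x))"
proof -
  have g: "continuous_on {0..1} \<gamma>" using assms(1) by (simp add: path_def)
  have "continuous_on (S \<times> cbox 0 1) (\<lambda>(x, t). f x (\<gamma> t) * vector_derivative \<gamma> (at t))"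
    unfolding split_beta
    by (intro continuous_intros continuous_on_compose2[OF f, of _ "\<lambda>p. (fst p, \<gamma> (snd p))", simplified]
        continuous_on_compose2[OF g, of _ snd] continuous_on_compose2[OF dg, of _ snd])
      (auto simp: path_image_def)
  from integral_continuous_on_param[OF this] show ?thesis
    by (simp add: contour_integral_integral)
qed

lemma continuous_on_vector_derivative_circlepath:
  "continuous_on S (\<lambda>t. vector_derivative (circlepath a r) (at t))"
  unfolding vector_derivative_circlepath by (intro continuous_intros)

text \<open>Morera's theorem: over a triangle the two integrations are exchanged, and for each fixed
  \<open>z\<close> the inner integral vanishes by Cauchy's theorem.\<close>

lemma holomorphic_on_contour_integral_param:
  fixes f :: "complex \<Rightarrow> complex \<Rightarrow> complex"
  assumes \<gamma>: "valid_path \<gamma>" and dg: "continuous_on {0..1} (\<lambda>t. vector_derivative \<gamma> (at t))"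
    and "open D"
    and f: "continuous_on (D \<times> path_image \<gamma>) (\<lambda>(w, z). f w z)"
    and hol: "\<And>z. z \<in> path_image \<gamma> \<Longrightarrow> (\<lambda>w. f w z) holomorphic_on D"
  shows "(\<lambda>w. contour_integral \<gamma> (f w)) holomorphic_on D"
proof -
  define h where "h = (\<lambda>w. contour_integral \<gamma> (f w))"
  have "continuous_on D h"
    unfolding h_def using continuous_on_contour_integral_param[OF valid_path_imp_path[OF \<gamma>] dg f] .
  moreover have "contour_integral (linepath a b) h + contour_integral (linepath b c) h
                   + contour_integral (linepath c a) h = 0"
    if abc: "convex hull {a, b, c} \<subseteq> D" for a b c
  proof -
    \<comment> \<open>\<open>J p q\<close> integrates along one side with \<open>z\<close> fixed.
      Its integrability along \<open>\<gamma>\<close> permits collecting the three sides under one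
      integral.\<close>
    define J where "J p q = (\<lambda>z. contour_integral (linepath p q) (\<lambda>w. f w z))" for p q
    have J: "contour_integral (linepath p q) h = contour_integral \<gamma> (J p q)"
            "J p q contour_integrable_on \<gamma>" if "closed_segment p q \<subseteq> D" for p q
    proof -
      have c: "continuous_on (closed_segment p q \<times> path_image \<gamma>) (\<lambda>(w, z). f w z)"
        using that by (intro continuous_on_subset[OF f]) auto
      show "contour_integral (linepath p q) h = contour_integral \<gamma> (J p q)"
        unfolding h_def J_def using c \<gamma> dg by (intro contour_integral_swap) auto
      have "continuous_on (path_image \<gamma>) (J p q)"
        unfolding J_def
      proof (rule continuous_on_contour_integral_param)
        show "continuous_on (path_image \<gamma> \<times> path_image (linepath p q)) (\<lambda>(z, w). f w z)"
          using continuous_on_swap_args[OF c] by simp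
      qed auto
      then have "continuous_on {0..1} (\<lambda>t. J p q (\<gamma> t))"
        using valid_path_imp_path[OF \<gamma>] continuous_on_compose[of "{0..1}" \<gamma> "J p q"]
        by (simp add: path_def path_image_def o_def)
      then show "J p q contour_integrable_on \<gamma>"
        unfolding contour_integrable_on
        using dg by (intro integrable_continuous_real continuous_intros)
    qed
    have seg: "closed_segment a b \<subseteq> D" "closed_segment b c \<subseteq> D" "closed_segment c a \<subseteq> D"
      using abc by (auto simp: segment_convex_hull intro!: subset_trans[OF hull_mono abc])
    have "contour_integral (linepath a b) h + contour_integral (linepath b c) h
            + contour_integral (linepath c a) h
          = contour_integral \<gamma> (\<lambda>z. J a b z + J b c z + J c a z)"
      using J seg by (simp add: contour_integral_add contour_integrable_add)
    also have "\<dots> = contour_integral \<gamma> (\<lambda>z. 0)"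
    proof (rule contour_integral_eq)
      fix z assume "z \<in> path_image \<gamma>"
      then have "(\<lambda>w. f w z) holomorphic_on convex hull {a, b, c}"
        using hol abc holomorphic_on_subset by blast
      then have int: "((\<lambda>w. f w z) has_contour_integral 0) (linepath a b +++ linepath b c +++ linepath c a)"
        by (rule Cauchy_theorem_triangle)
      have cont: "continuous_on D (\<lambda>w. f w z)"
        using hol \<open>z \<in> path_image \<gamma>\<close> holomorphic_on_imp_continuous_on by blast
      then have "(\<lambda>w. f w z) contour_integrable_on linepath p q" if "closed_segment p q \<subseteq> D" for p q
        using that contour_integrable_continuous_linepath continuous_on_subset by blast
      then show "J a b z + J b c z + J c a z = 0"
        using contour_integral_unique[OF int] seg unfolding J_def
        by (simp add: contour_integral_join contour_integrable_join add.assoc)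
    qed
    finally show ?thesis by simp
  qed
  ultimately have "h analytic_on D"
    using \<open>open D\<close> Morera_triangle by blast
  then show ?thesis unfolding h_def by (rule analytic_imp_holomorphic)
qed

section \<open>Zeros of holomorphic functions of two variables\<close>

text \<open>Joint continuity is built in, so that circle integrals depend continuously on parameters
  without recourse to Hartogs' theorem.\<close>

definition separately_holomorphic_on ::
  "(complex \<Rightarrow> complex \<Rightarrow> complex) \<Rightarrow> complex set \<Rightarrow> complex set \<Rightarrow> bool" where
  "separately_holomorphic_on f A D \<longleftrightarrow>
     continuous_on (A \<times> D) (\<lambda>(z, w). f z w) \<and>
     (\<forall>w\<in>D. (\<lambda>z. f z w) holomorphic_on A) \<and> (\<forall>z\<in>A. f z holomorphic_on D)"

section \<open>Closure properties of separately holomorphic functions\<close>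

lemma separately_holomorphic_on_const: "separately_holomorphic_on (\<lambda>z w. c) A D"
  by (auto simp: separately_holomorphic_on_def split_beta intro!: holomorphic_intros continuous_intros)

lemma separately_holomorphic_on_add:
  assumes "separately_holomorphic_on f A D" "separately_holomorphic_on g A D"
  shows "separately_holomorphic_on (\<lambda>z w. f z w + g z w) A D"
  using assms by (auto simp: separately_holomorphic_on_def split_beta intro!: holomorphic_intros continuous_intros)

lemma separately_holomorphic_on_mult:
  assumes "separately_holomorphic_on f A D" "separately_holomorphic_on g A D"
  shows "separately_holomorphic_on (\<lambda>z w. f z w * g z w) A D"
  using assms by (auto simp: separately_holomorphic_on_def split_beta intro!: holomorphic_intros continuous_intros)

lemma separately_holomorphic_on_one_minus_power:
  assumes "separately_holomorphic_on f A D"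
  shows "separately_holomorphic_on (\<lambda>z w. (1 - f z w) ^ n) A D"
  using assms by (auto simp: separately_holomorphic_on_def split_beta intro!: holomorphic_intros continuous_intros)

text \<open>A combination of \<open>gs\<close> weighted by powers of \<open>t\<close>, written as a
  polynomial value so that its zeros in \<open>t\<close> can be counted later.\<close>

lemma separately_holomorphic_on_poly_Poly:
  assumes "\<forall>g\<in>set gs. separately_holomorphic_on g A D"
  shows "separately_holomorphic_on (\<lambda>z w. poly (Poly (map (\<lambda>g. g z w) gs)) t) A D"
  using assms
  by (induction gs)
    (auto intro!: separately_holomorphic_on_const separately_holomorphic_on_add separately_holomorphic_on_mult)

lemma separately_holomorphic_on_subset:
  assumes "separately_holomorphic_on f A D" "A' \<subseteq> A" "D' \<subseteq> D"
  shows "separately_holomorphic_on f A' D'"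
  using assms unfolding separately_holomorphic_on_def
  by (meson Sigma_mono continuous_on_subset holomorphic_on_subset subsetD)

lemma separately_holomorphic_on_imp_continuous_on:
  assumes "separately_holomorphic_on f A D"
    and "continuous_on S p" "continuous_on S q" "p ` S \<subseteq> A" "q ` S \<subseteq> D"
  shows "continuous_on S (\<lambda>x. f (p x) (q x))"
proof -
  have "continuous_on (A \<times> D) (\<lambda>(z, w). f z w)"
    using assms(1) by (simp add: separately_holomorphic_on_def)
  from continuous_on_compose2[OF this, of S "\<lambda>x. (p x, q x)"] assms(2-) show ?thesis
    by (auto intro: continuous_intros)
qed

text \<open>Cauchy's formula over a circle of radius \<open>s < r\<close> writes the derivative as
  an integral with parameters \<open>z\<close> and \<open>w\<close>. The smaller radius keeps the
  circle where \<open>f\<close> is holomorphic, and every point of \<open>ball a r\<close> lies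
  inside such a circle.\<close>

lemma deriv_separately_holomorphic_on:
  assumes f: "separately_holomorphic_on f (ball a r) D" and "open D"
  shows "separately_holomorphic_on (\<lambda>z w. deriv (\<lambda>z. f z w) z) (ball a r) D"
proof -
  define d where "d = (\<lambda>z w. deriv (\<lambda>z. f z w) z)"
  have *: "continuous_on (ball a s \<times> D) (\<lambda>(z, w). d z w) \<and> (\<forall>z\<in>ball a s. d z holomorphic_on D)"
    if s: "0 < s" "s < r" for s
  proof -
    define I where "I = (\<lambda>z w. contour_integral (circlepath a s) (\<lambda>u. f u w / (u - z)\<^sup>2) / (2 * pi * \<i>))"
    have dI: "d z w = I z w" if "z \<in> ball a s" "w \<in> D" for z w
    proof -
      have "(\<lambda>z. f z w) holomorphic_on ball a r"
        using f that by (auto simp: separately_holomorphic_on_def)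
      then have "(\<lambda>z. f z w) holomorphic_on cball a s"
        using s by (auto elim: holomorphic_on_subset)
      then have "continuous_on (cball a s) (\<lambda>z. f z w)" "(\<lambda>z. f z w) holomorphic_on ball a s"
        by (auto intro: holomorphic_on_imp_continuous_on elim: holomorphic_on_subset)
      from Cauchy_contour_integral_circlepath_2[OF this that(1)] show ?thesis
        by (simp add: d_def I_def)
    qed
    have cont: "continuous_on ((ball a s \<times> D) \<times> sphere a s) (\<lambda>(p, u). f u (snd p) / (u - fst p)\<^sup>2)"
      unfolding split_beta using s
      by (intro continuous_intros separately_holomorphic_on_imp_continuous_on[OF f]) auto
    have "continuous_on (ball a s \<times> D) (\<lambda>p. contour_integral (circlepath a s) (\<lambda>u. f u (snd p) / (u - fst p)\<^sup>2))"
      using cont s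
      by (intro continuous_on_contour_integral_param continuous_on_vector_derivative_circlepath) auto
    then have "continuous_on (ball a s \<times> D) (\<lambda>p. I (fst p) (snd p))"
      unfolding I_def by (intro continuous_intros) auto
    then have "continuous_on (ball a s \<times> D) (\<lambda>(z, w). d z w)"
      by (rule continuous_on_eq) (auto simp: dI)
    moreover have "d z holomorphic_on D" if z: "z \<in> ball a s" for z
    proof -
      have "(\<lambda>w. contour_integral (circlepath a s) (\<lambda>u. f u w / (u - z)\<^sup>2)) holomorphic_on D"
      proof (rule holomorphic_on_contour_integral_param[OF _ _ \<open>open D\<close>])
        show "continuous_on (D \<times> path_image (circlepath a s)) (\<lambda>(w, u). f u w / (u - z)\<^sup>2)"
          unfolding split_beta using s z
          by (intro continuous_intros separately_holomorphic_on_imp_continuous_on[OF f]) auto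
        show "(\<lambda>w. f u w / (u - z)\<^sup>2) holomorphic_on D" if "u \<in> path_image (circlepath a s)" for u
          using f that s z by (intro holomorphic_intros) (auto simp: separately_holomorphic_on_def)
      qed (auto intro: continuous_on_vector_derivative_circlepath)
      then have "I z holomorphic_on D"
        unfolding I_def by (intro holomorphic_intros) auto
      then show ?thesis
        using z by (auto simp: dI elim: holomorphic_transform)
    qed
    ultimately show ?thesis by blast
  qed
  have between: "\<exists>s. 0 < s \<and> s < r \<and> z \<in> ball a s" if "z \<in> ball a r" for z
  proof -
    from that obtain s where "dist a z < s" "s < r" using dense by auto
    then show ?thesis by (intro exI[of _ s]) (auto intro: le_less_trans[OF zero_le_dist])
  qed
  have "continuous_on (ball a r \<times> D) (\<lambda>(z, w). d z w)"
    unfolding continuous_on_eq_continuous_at[OF open_Times[OF open_ball \<open>open D\<close>]]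
  proof
    fix p assume p: "p \<in> ball a r \<times> D"
    then obtain s where s: "0 < s" "s < r" "fst p \<in> ball a s"
      using between[of "fst p"] by (auto simp: mem_Times_iff)
    then have "p \<in> ball a s \<times> D" using p by (auto simp: mem_Times_iff)
    then show "isCont (\<lambda>(z, w). d z w) p"
      using *[OF s(1,2)] continuous_on_eq_continuous_at[OF open_Times[OF open_ball \<open>open D\<close>]] by blast
  qed
  moreover have "d z holomorphic_on D" if "z \<in> ball a r" for z
    using between[OF that] * by blast
  moreover have "(\<lambda>z. d z w) holomorphic_on ball a r" if "w \<in> D" for w
    using f that unfolding d_def separately_holomorphic_on_def by (intro holomorphic_deriv) auto
  ultimately show ?thesis unfolding d_def separately_holomorphic_on_def by blast
qed

text \<open>Zeros are isolated and \<open>cball a s\<close> is compact inside the larger ball; the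
  point \<open>z\<^sub>0\<close> excludes the zero function.\<close>

lemma finite_zeros_in_ball:
  assumes f: "f holomorphic_on ball a r" and "s < r" "z\<^sub>0 \<in> ball a r" "f z\<^sub>0 \<noteq> (0::complex)"
  shows "finite {z\<in>cball a s. f z = 0}"
proof (cases "f constant_on ball a r")
  case True
  then have "{z\<in>cball a s. f z = 0} = {}"
    using assms unfolding constant_on_def by auto
  then show ?thesis by (simp only: finite.emptyI)
next
  case False
  show ?thesis
    by (rule holomorphic_compact_finite_zeros[OF f _ _ _ _ False]) (use assms in auto)
qed

text \<open>Weighted argument principle: the sum is the integral of \<open>f' h / f\<close> over the
  circle of radius \<open>\<rho>\<close>, divided by \<open>2 pi i\<close>. As \<open>f\<close> has
  no zero on the circle, the integrand is continuous there and holomorphic in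
  \<open>w\<close>.\<close>

lemma holomorphic_on_sum_over_zeros:
  assumes f: "separately_holomorphic_on f (ball a r) D" and h: "separately_holomorphic_on h (ball a r) D"
    and "open D" and \<rho>: "0 < \<rho>" "\<rho> < r"
    and nz: "\<And>z w. z \<in> sphere a \<rho> \<Longrightarrow> w \<in> D \<Longrightarrow> f z w \<noteq> 0"
  shows "(\<lambda>w. \<Sum>z | z \<in> ball a \<rho> \<and> f z w = 0. of_nat (nat (zorder (\<lambda>z. f z w) z)) * h z w) holomorphic_on D"
proof -
  define \<phi> where "\<phi> = (\<lambda>w z. deriv (\<lambda>z. f z w) z * h z w / f z w)"
  have df: "separately_holomorphic_on (\<lambda>z w. deriv (\<lambda>z. f z w) z) (ball a r) D"
    using deriv_separately_holomorphic_on[OF f \<open>open D\<close>] .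
  have "(\<lambda>w. contour_integral (circlepath a \<rho>) (\<phi> w)) holomorphic_on D"
  proof (rule holomorphic_on_contour_integral_param[OF _ _ \<open>open D\<close>])
    show "continuous_on (D \<times> path_image (circlepath a \<rho>)) (\<lambda>(w, z). \<phi> w z)"
      unfolding split_beta \<phi>_def using \<rho> nz
      by (intro continuous_intros separately_holomorphic_on_imp_continuous_on[OF f]
          separately_holomorphic_on_imp_continuous_on[OF h] separately_holomorphic_on_imp_continuous_on[OF df]) auto
    show "(\<lambda>w. \<phi> w z) holomorphic_on D" if "z \<in> path_image (circlepath a \<rho>)" for z
      unfolding \<phi>_def using that \<rho> nz f df h
      by (intro holomorphic_intros) (auto simp: separately_holomorphic_on_def)
  qed (auto intro: continuous_on_vector_derivative_circlepath)
  then have "(\<lambda>w. contour_integral (circlepath a \<rho>) (\<phi> w) / (2 * pi * \<i>)) holomorphic_on D"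
    by (intro holomorphic_intros) auto
  then show ?thesis
  proof (rule holomorphic_transform)
    fix w assume w: "w \<in> D"
    define fw where "fw = (\<lambda>z. f z w)"
    \<comment> \<open>The argument principle is applied in \<open>ball a s\<close>: it contains the
      circle, and its closure lies in \<open>ball a r\<close>, so it holds finitely many
      zeros.\<close>
    obtain s where s: "\<rho> < s" "s < r" using dense[OF \<rho>(2)] by blast
    \<comment> \<open>The empty set stands for the poles.\<close>
    define Z where "Z = {z \<in> ball a s. fw z = 0 \<or> z \<in> {}}"
    obtain z0 where z0: "z0 \<in> sphere a \<rho>"
      using \<rho> by (metis dist_commute dist_norm less_imp_le mem_sphere vector_choose_dist)
    have hol: "fw holomorphic_on ball a r" "(\<lambda>z. h z w) holomorphic_on ball a r"
      using f h w by (auto simp: fw_def separately_holomorphic_on_def)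
    have "finite {z\<in>cball a s. fw z = 0}"
      using finite_zeros_in_ball[OF hol(1) s(2)] z0 \<rho> nz[OF z0 w] by (auto simp: fw_def)
    then have fin: "finite Z"
      by (rule rev_finite_subset) (auto simp: Z_def)
    have holS: "fw holomorphic_on ball a s" "(\<lambda>z. h z w) holomorphic_on ball a s"
      using hol s by (auto elim!: holomorphic_on_subset)
    have out: "winding_number (circlepath a \<rho>) z = 0" if "z \<notin> cball a \<rho>" for z
      by (rule winding_number_zero_outside[of _ "cball a \<rho>"]) (use \<rho> that in auto)
    have "contour_integral (circlepath a \<rho>) (\<lambda>x. deriv fw x * h x w / fw x) =
            2 * pi * \<i> * (\<Sum>p\<in>Z. winding_number (circlepath a \<rho>) p * h p w * zorder fw p)"
      unfolding Z_def
    proof (rule argument_principle)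
      show "\<forall>z. z \<notin> ball a s \<longrightarrow> winding_number (circlepath a \<rho>) z = 0"
        using out s by auto
      show "finite {w \<in> ball a s. fw w = 0 \<or> w \<in> {}}" using fin by (simp add: Z_def)
      show "path_image (circlepath a \<rho>) \<subseteq> ball a s - {w \<in> ball a s. fw w = 0 \<or> w \<in> {}}"
        using s \<rho> nz w by (auto simp: fw_def)
    qed (use holS in auto)
    also have "(\<Sum>p\<in>Z. winding_number (circlepath a \<rho>) p * h p w * zorder fw p) =
               (\<Sum>p | p \<in> ball a \<rho> \<and> f p w = 0. of_nat (nat (zorder fw p)) * h p w)"
    \<comment> \<open>Zeros outside the circle have winding number \<open>0\<close>, none lies on
      it, and those inside have winding number \<open>1\<close>.\<close>
    proof (rule sum.mono_neutral_cong_right[OF fin])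
      show "{p. p \<in> ball a \<rho> \<and> f p w = 0} \<subseteq> Z" using s by (auto simp: Z_def fw_def)
      show "\<forall>p\<in>Z - {p. p \<in> ball a \<rho> \<and> f p w = 0}. winding_number (circlepath a \<rho>) p * h p w * zorder fw p = 0"
      proof
        fix p assume "p \<in> Z - {p. p \<in> ball a \<rho> \<and> f p w = 0}"
        then have "p \<notin> ball a \<rho>" "fw p = 0" by (auto simp: Z_def fw_def)
        then have "p \<notin> cball a \<rho>" using nz[of p w] w by (auto simp: fw_def)
        then show "winding_number (circlepath a \<rho>) p * h p w * zorder fw p = 0" by (simp add: out)
      qed
      fix p assume p: "p \<in> {p. p \<in> ball a \<rho> \<and> f p w = 0}"
      \<comment> \<open>Turning the order into a natural number loses nothing: it is positive, since
        \<open>fw\<close> vanishes at \<open>p\<close> but not at \<open>z0\<close>.\<close>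
      have "zorder fw p > 0"
        using zorder_exist_zero[OF hol(1), of p] p \<rho> z0 nz[OF z0 w] by (force simp: fw_def)
      moreover have "winding_number (circlepath a \<rho>) p = 1"
        using p by (intro winding_number_circlepath) (auto simp: dist_norm norm_minus_commute)
      ultimately show "winding_number (circlepath a \<rho>) p * h p w * zorder fw p
                         = of_nat (nat (zorder fw p)) * h p w"
        by simp
    qed
    finally show "contour_integral (circlepath a \<rho>) (\<phi> w) / (2 * pi * \<i>) =
        (\<Sum>z | z \<in> ball a \<rho> \<and> f z w = 0. of_nat (nat (zorder (\<lambda>z. f z w) z)) * h z w)"
      by (simp add: \<phi>_def fw_def)
  qed
qed

text \<open>\<open>R w\<close> multiplies the values of \<open>g\<close> over the zeros of
  \<open>f\<close>, with multiplicity. The radius \<open>\<epsilon>\<close> is fixed before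
  \<open>g\<close>, as it depends only on the number of zeros of \<open>f\<close>; later one radius
  must serve all parameters \<open>t\<close>.\<close>

lemma resultant_exists:
  assumes f: "separately_holomorphic_on f (ball a r) D"
    and "open D" "b \<in> D" and \<rho>: "0 < \<rho>" "\<rho> < r"
    and nz: "\<And>z w. z \<in> sphere a \<rho> \<Longrightarrow> w \<in> D \<Longrightarrow> f z w \<noteq> 0"
  obtains \<epsilon> where "0 < \<epsilon>" "ball b \<epsilon> \<subseteq> D"
    "\<forall>g. separately_holomorphic_on g (ball a r) D \<longrightarrow>
       (\<exists>R. R holomorphic_on ball b \<epsilon> \<and>
           (\<forall>w\<in>ball b \<epsilon>. R w = 0 \<longleftrightarrow> (\<exists>z\<in>ball a \<rho>. f z w = 0 \<and> g z w = 0)))"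
proof -
  define Z where "Z w = {z. z \<in> ball a \<rho> \<and> f z w = 0}" for w
  define m where "m w z = nat (zorder (\<lambda>z. f z w) z)" for w z
  obtain z0 where z0: "z0 \<in> sphere a \<rho>"
    using \<rho> by (metis dist_commute dist_norm less_imp_le mem_sphere vector_choose_dist)
  have hol: "(\<lambda>z. f z w) holomorphic_on ball a r" if "w \<in> D" for w
    using f that by (auto simp: separately_holomorphic_on_def)
  have z0r: "z0 \<in> ball a r" using z0 \<rho> by simp
  have fin: "finite (Z w)" if "w \<in> D" for w
    by (rule finite_subset[OF _ finite_zeros_in_ball[OF hol[OF that] \<rho>(2) z0r nz[OF z0 that]]])
      (auto simp: Z_def)
  \<comment> \<open>A positive exponent makes \<open>g z w ^ m w z\<close> vanish exactly when
    \<open>g z w\<close> does.\<close>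
  have m: "m w z > 0" if "w \<in> D" "z \<in> Z w" for w z
  proof -
    have "z \<in> ball a r" "\<exists>z\<in>ball a r. f z w \<noteq> 0" "f z w = 0"
      using that \<rho> z0r nz[OF z0 that(1)] by (auto simp: Z_def)
    then show ?thesis
      using zorder_exist_zero[OF hol[OF that(1)] open_ball connected_ball, of z] by (simp add: m_def)
  qed
  have sums: "(\<lambda>w. \<Sum>z\<in>Z w. of_nat (m w z) * h z w) holomorphic_on D"
    if "separately_holomorphic_on h (ball a r) D" for h
    using holomorphic_on_sum_over_zeros[OF f that \<open>open D\<close> \<rho> nz] by (simp add: Z_def m_def)
  \<comment> \<open>With weight \<open>1\<close> the sum counts zeros with multiplicity. It is
    continuous and integer-valued, so near \<open>b\<close> it cannot exceed its value at
    \<open>b\<close>; this supplies the bound \<open>K\<close>.\<close>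
  have "(\<lambda>w. \<Sum>z\<in>Z w. of_nat (m w z) * 1) holomorphic_on D"
    using sums separately_holomorphic_on_const by blast
  then have "(\<lambda>w. of_nat (\<Sum>z\<in>Z w. m w z) :: complex) holomorphic_on D" by simp
  then have "continuous_on D (\<lambda>w. of_nat (\<Sum>z\<in>Z w. m w z) :: complex)"
    by (rule holomorphic_on_imp_continuous_on)
  then have "isCont (\<lambda>w. of_nat (\<Sum>z\<in>Z w. m w z) :: complex) b"
    using \<open>b \<in> D\<close> continuous_on_eq_continuous_at[OF \<open>open D\<close>] by blast
  from this[unfolded continuous_at_eps_delta, rule_format, OF zero_less_one] obtain \<delta> where \<delta>: "\<delta> > 0"
    "\<And>w. dist w b < \<delta> \<Longrightarrow> dist (of_nat (\<Sum>z\<in>Z w. m w z) :: complex) (of_nat (\<Sum>z\<in>Z b. m b z)) < 1"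
    by blast
  obtain \<delta>' where \<delta>': "\<delta>' > 0" "ball b \<delta>' \<subseteq> D"
    using \<open>open D\<close> \<open>b \<in> D\<close> openE by blast
  define \<epsilon> where "\<epsilon> = min \<delta> \<delta>'"
  show thesis
  proof
    show "0 < \<epsilon>" and "ball b \<epsilon> \<subseteq> D" using \<delta> \<delta>' by (auto simp: \<epsilon>_def)
  next
    have sub: "ball b \<epsilon> \<subseteq> D" using \<delta>' by (auto simp: \<epsilon>_def)
    show "\<forall>g. separately_holomorphic_on g (ball a r) D \<longrightarrow>
       (\<exists>R. R holomorphic_on ball b \<epsilon> \<and>
           (\<forall>w\<in>ball b \<epsilon>. R w = 0 \<longleftrightarrow> (\<exists>z\<in>ball a \<rho>. f z w = 0 \<and> g z w = 0)))"
    proof (intro allI impI)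
      fix g assume g: "separately_holomorphic_on g (ball a r) D"
      define R where "R = (\<lambda>w. \<Prod>z\<in>Z w. g z w ^ m w z)"
      have "R holomorphic_on ball b \<epsilon>"
        unfolding R_def
      proof (rule holomorphic_on_weighted_product[where K = "\<Sum>z\<in>Z b. m b z"])
        fix w assume w: "w \<in> ball b \<epsilon>"
        show "finite (Z w)" using fin sub w by blast
        have "cmod (of_nat (\<Sum>z\<in>Z w. m w z) - of_nat (\<Sum>z\<in>Z b. m b z)) < 1"
          using \<delta>(2)[of w] w by (simp add: \<epsilon>_def dist_commute flip: dist_norm)
        then have "cmod (of_int (int (\<Sum>z\<in>Z w. m w z) - int (\<Sum>z\<in>Z b. m b z))) < 1"
          by (simp only: of_int_diff of_int_of_nat_eq)
        then show "(\<Sum>z\<in>Z w. m w z) \<le> (\<Sum>z\<in>Z b. m b z)"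
          unfolding norm_of_int by linarith
      next
        fix n
        show "(\<lambda>w. \<Sum>z\<in>Z w. of_nat (m w z) * (1 - g z w) ^ n) holomorphic_on ball b \<epsilon>"
          using sums[OF separately_holomorphic_on_one_minus_power[OF g]] sub
          by (rule holomorphic_on_subset)
      qed
      moreover have "R w = 0 \<longleftrightarrow> (\<exists>z\<in>ball a \<rho>. f z w = 0 \<and> g z w = 0)" if "w \<in> ball b \<epsilon>" for w
      proof -
        have "w \<in> D" using that sub by blast
        have "R w = 0 \<longleftrightarrow> (\<exists>z\<in>Z w. g z w ^ m w z = 0)"
          unfolding R_def by (rule prod_zero_iff[OF fin[OF \<open>w \<in> D\<close>]])
        also have "\<dots> \<longleftrightarrow> (\<exists>z\<in>Z w. g z w = 0)"
          using m[OF \<open>w \<in> D\<close>] by (intro bex_cong) simp_all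
        finally show ?thesis by (auto simp: Z_def)
      qed
      ultimately show "\<exists>R. R holomorphic_on ball b \<epsilon> \<and>
             (\<forall>w\<in>ball b \<epsilon>. R w = 0 \<longleftrightarrow> (\<exists>z\<in>ball a \<rho>. f z w = 0 \<and> g z w = 0))" by blast
    qed
  qed
qed

text \<open>A resultant handles only one further function, so the members of \<open>G\<close> are
  packed into a polynomial in \<open>t\<close>; for each \<open>t\<close> the identity theorem makes
  the resultant vanish identically.\<close>

lemma common_zeros_nearby:
  assumes f: "separately_holomorphic_on f (ball a r) D"
    and "open D" "b \<in> D" and \<rho>: "0 < \<rho>" "\<rho> < r"
    and nz: "\<And>z w. z \<in> sphere a \<rho> \<Longrightarrow> w \<in> D \<Longrightarrow> f z w \<noteq> 0"
    and "finite G" and G: "\<And>g. g \<in> G \<Longrightarrow> separately_holomorphic_on g (ball a r) D"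
    and lim: "b islimpt {w. \<exists>z\<in>ball a \<rho>. f z w = 0 \<and> (\<forall>g\<in>G. g z w = 0)}" (is "b islimpt ?E")
  obtains \<epsilon> where "0 < \<epsilon>" "ball b \<epsilon> \<subseteq> ?E"
proof -
  obtain \<epsilon> where \<epsilon>: "0 < \<epsilon>" "ball b \<epsilon> \<subseteq> D"
    and res: "\<forall>g. separately_holomorphic_on g (ball a r) D \<longrightarrow>
       (\<exists>R. R holomorphic_on ball b \<epsilon> \<and>
           (\<forall>w\<in>ball b \<epsilon>. R w = 0 \<longleftrightarrow> (\<exists>z\<in>ball a \<rho>. f z w = 0 \<and> g z w = 0)))"
    by (rule resultant_exists[OF f \<open>open D\<close> \<open>b \<in> D\<close> \<rho> nz])
  obtain gs where gs: "set gs = G" using finite_list[OF \<open>finite G\<close>] by blast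
  \<comment> \<open>\<open>Poly\<close> strips trailing zeros, so \<open>p z w = 0\<close> means
    exactly that all listed values vanish.\<close>
  define p where "p z w = Poly (map (\<lambda>g. g z w) gs)" for z w :: complex
  have p0: "p z w = 0 \<longleftrightarrow> (\<forall>g\<in>G. g z w = 0)" for z w
  proof
    assume "p z w = 0"
    then obtain n where "map (\<lambda>g. g z w) gs = replicate n 0" by (auto simp: p_def Poly_eq_0)
    then have "\<forall>x\<in>set (map (\<lambda>g. g z w) gs). x = 0" by (simp only:) simp
    then show "\<forall>g\<in>G. g z w = 0" using gs by auto
  next
    assume "\<forall>g\<in>G. g z w = 0"
    then have "map (\<lambda>g. g z w) gs = replicate (length gs) 0"
      using gs by (auto intro!: nth_equalityI)
    then show "p z w = 0" by (auto simp: p_def)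
  qed
  have root: "\<exists>z\<in>ball a \<rho>. f z w = 0 \<and> poly (p z w) t = 0" if w: "w \<in> ball b \<epsilon>" for w t
  proof -
    have "separately_holomorphic_on (\<lambda>z w. poly (p z w) t) (ball a r) D"
      unfolding p_def using G gs by (intro separately_holomorphic_on_poly_Poly) auto
    from res[rule_format, OF this] obtain R where R: "R holomorphic_on ball b \<epsilon>"
      "\<And>w. w \<in> ball b \<epsilon> \<Longrightarrow> R w = 0 \<longleftrightarrow> (\<exists>z\<in>ball a \<rho>. f z w = 0 \<and> poly (p z w) t = 0)"
      by blast
    have "b islimpt (?E \<inter> ball b \<epsilon>)"
      using lim \<epsilon>(1) by (intro islimpt_Int_eventually eventually_at_in_open') auto
    moreover have "R w = 0" if "w \<in> ?E \<inter> ball b \<epsilon>" for w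
    proof -
      from that obtain z where "z \<in> ball a \<rho>" "f z w = 0" "p z w = 0" using p0 by blast
      then have "\<exists>z\<in>ball a \<rho>. f z w = 0 \<and> poly (p z w) t = 0"
        by (intro bexI[of _ z]) simp_all
      then show ?thesis using R(2) that by blast
    qed
    ultimately have "R w = 0"
      using analytic_continuation[OF R(1) open_ball connected_ball Int_lower2 _ _ _ w, of b ?E] \<epsilon>(1)
        centre_in_ball by blast
    then show ?thesis using R(2) w by blast
  qed
  have "ball b \<epsilon> \<subseteq> ?E"
  proof
    fix w assume w: "w \<in> ball b \<epsilon>"
    then have "w \<in> D" using \<epsilon> by blast
    obtain z0 where z0: "z0 \<in> sphere a \<rho>"
      using \<rho> by (metis dist_commute dist_norm less_imp_le mem_sphere vector_choose_dist)
    have "(\<lambda>z. f z w) holomorphic_on ball a r"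
      using f \<open>w \<in> D\<close> by (auto simp: separately_holomorphic_on_def)
    then have "finite {z\<in>cball a \<rho>. f z w = 0}"
      by (rule finite_zeros_in_ball[where f = "\<lambda>z. f z w" and z\<^sub>0 = z0])
        (use z0 \<rho> nz[OF z0 \<open>w \<in> D\<close>] in auto)
    then have fin: "finite {z\<in>ball a \<rho>. f z w = 0}"
      by (rule rev_finite_subset) auto
    \<comment> \<open>Infinitely many \<open>t\<close> share finitely many zeros of
      \<open>f\<close>, so some \<open>z\<close> serves infinitely many \<open>t\<close>; there
      \<open>p z w\<close> has infinitely many roots and is zero.\<close>
    have "\<exists>z\<in>{z\<in>ball a \<rho>. f z w = 0}. infinite {t\<in>UNIV. poly (p z w) t = 0}"
      using root[OF w] by (intro pigeonhole_infinite_rel[OF infinite_UNIV_char_0 fin]) blast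
    then obtain z where z: "z \<in> ball a \<rho>" "f z w = 0" "infinite {t. poly (p z w) t = 0}" by auto
    then have "p z w = 0" using poly_roots_finite by blast
    then show "w \<in> ?E" using z p0 by blast
  qed
  then show thesis using that \<epsilon>(1) by blast
qed

section \<open>Local images of analytic sets under the second projection\<close>

lemma separately_holomorphic_on_holomorphic2:
  assumes f: "holomorphic2_on f V" and AD: "A \<times> D \<subseteq> V"
  shows "separately_holomorphic_on (\<lambda>z w. f (z, w)) A D"
proof -
  have "continuous_on (A \<times> D) f"
  proof (rule continuous_at_imp_continuous_on, rule ballI)
    fix p assume "p \<in> A \<times> D"
    then obtain \<alpha> \<beta> where "(f has_derivative (\<lambda>(h, k). \<alpha> * h + \<beta> * k)) (at p)"
      using f AD unfolding holomorphic2_on_def by blast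
    then show "isCont f p" by (rule has_derivative_continuous)
  qed
  moreover have "(\<lambda>z. f (z, w)) holomorphic_on A" "(\<lambda>w. f (z, w)) holomorphic_on D"
    if "z \<in> A" "w \<in> D" for z w
  proof -
    have der: "\<exists>\<alpha> \<beta>. (f has_derivative (\<lambda>(h, k). \<alpha> * h + \<beta> * k)) (at (z, w))"
      if "z \<in> A" "w \<in> D" for z w
      using that f AD unfolding holomorphic2_on_def by blast
    show "(\<lambda>z. f (z, w)) holomorphic_on A"
      unfolding holomorphic_on_def field_differentiable_def has_field_derivative_def
    proof
      fix z assume "z \<in> A"
      then obtain \<alpha> \<beta> where "(f has_derivative (\<lambda>(h, k). \<alpha> * h + \<beta> * k)) (at (z, w))"
        using der \<open>w \<in> D\<close> by blast
      moreover have "((\<lambda>z. (z, w)) has_derivative (\<lambda>h. (h, 0))) (at z within A)"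
        by (auto intro!: derivative_eq_intros)
      ultimately have "((\<lambda>z. f (z, w)) has_derivative (\<lambda>h. \<alpha> * h)) (at z within A)"
        using has_derivative_compose by fastforce
      then
      show "\<exists>f'. ((\<lambda>z. f (z, w)) has_derivative (*) f') (at z within A)"
        by blast
    qed
    show "(\<lambda>w. f (z, w)) holomorphic_on D"
      unfolding holomorphic_on_def field_differentiable_def has_field_derivative_def
    proof
      fix w assume "w \<in> D"
      then obtain \<alpha> \<beta> where "(f has_derivative (\<lambda>(h, k). \<alpha> * h + \<beta> * k)) (at (z, w))"
        using der \<open>z \<in> A\<close> by blast
      moreover have "((\<lambda>w. (z, w)) has_derivative (\<lambda>h. (0, h))) (at w within D)"
        by (auto intro!: derivative_eq_intros)
      ultimately have "((\<lambda>w. f (z, w)) has_derivative (\<lambda>h. \<beta> * h)) (at w within D)"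
        using has_derivative_compose by fastforce
      then
      show "\<exists>f'. ((\<lambda>w. f (z, w)) has_derivative (*) f') (at w within D)"
        by blast
    qed
  qed
  ultimately show ?thesis
    unfolding separately_holomorphic_on_def
    \<comment> \<open>The slice facts were obtained from a point of \<open>A\<close> and a point of
      \<open>D\<close>, hence the separate case of an empty factor.\<close>
    by (cases "A = {} \<or> D = {}") (auto simp: split_beta holomorphic_on_def)
qed

text \<open>On the compact circle the values at \<open>b\<close> stay at distance \<open>e\<close>
  from \<open>0\<close>, and they change by at most \<open>e / 2\<close> for \<open>w\<close> close
  to \<open>b\<close>, uniformly along the circle.\<close>

lemma nonzero_on_sphere_nearby:
  fixes f :: "complex \<Rightarrow> complex \<Rightarrow> complex"
  assumes f: "separately_holomorphic_on f (ball a r) (ball b r)" and \<rho>: "\<rho> < r" "0 < r"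
    and nz: "\<And>z. z \<in> sphere a \<rho> \<Longrightarrow> f z b \<noteq> 0"
  obtains \<delta> where "0 < \<delta>" "\<delta> \<le> r" "\<And>z w. z \<in> sphere a \<rho> \<Longrightarrow> w \<in> ball b \<delta> \<Longrightarrow> f z w \<noteq> 0"
proof -
  have "continuous_on (sphere a \<rho>) (\<lambda>z. f z b)"
    using \<rho> by (intro separately_holomorphic_on_imp_continuous_on[OF f] continuous_intros) auto
  then have "closed ((\<lambda>z. f z b) ` sphere a \<rho>)"
    by (intro compact_imp_closed compact_continuous_image) auto
  moreover have "0 \<notin> (\<lambda>z. f z b) ` sphere a \<rho>" using nz by force
  ultimately obtain e where e: "e > 0" "\<And>z. z \<in> sphere a \<rho> \<Longrightarrow> e \<le> dist 0 (f z b)"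
    by (metis separate_point_closed imageI)
  have cont: "continuous_on (ball b r \<times> sphere a \<rho>) (\<lambda>p. f (snd p) (fst p))"
    using \<rho> by (intro separately_holomorphic_on_imp_continuous_on[OF f] continuous_intros) auto
  have "b \<in> ball b r" "0 < e / 2" using \<rho> e by auto
  then obtain X where X: "b \<in> X" "open X"
    "\<forall>w\<in>X \<inter> ball b r. \<forall>z\<in>sphere a \<rho>. dist (f z w) (f z b) \<le> e / 2"
    by (rule continuous_on_prod_compactE[OF cont compact_sphere, unfolded fst_conv snd_conv])
  obtain \<delta> where \<delta>: "0 < \<delta>" "ball b \<delta> \<subseteq> X" using X openE by blast
  show thesis
  proof
    show "0 < min \<delta> r" "min \<delta> r \<le> r" using \<delta> \<rho> by auto
    fix z w assume zw: "z \<in> sphere a \<rho>" "w \<in> ball b (min \<delta> r)"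
    then have "w \<in> X \<inter> ball b r" using \<delta> by auto
    then have "dist (f z w) (f z b) \<le> e / 2" using X(3) zw(1) by blast
    then show "f z w \<noteq> 0" using e(1) e(2)[OF zw(1)] by (auto simp: dist_commute)
  qed
qed

text \<open>\<open>fin\<close> isolates \<open>a\<close> in its fibre and \<open>lim\<close>
  supplies points of \<open>S\<close> over values other than \<open>b\<close>. The set
  \<open>A\<close> restricts the first coordinate, as needed for images of open sets.\<close>

lemma analytic_subset_snd_image_neighbourhood:
  assumes S: "analytic_subset_C2 S" and ab: "(a, b) \<in> S" and fin: "finite {z. (z, b) \<in> S}"
    and lim: "(a, b) islimpt S" and A: "open A" "a \<in> A"
  obtains \<epsilon> where "0 < \<epsilon>" "ball b \<epsilon> \<subseteq> snd ` (S \<inter> A \<times> UNIV)"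
proof -
  from S[unfolded analytic_subset_C2_def, rule_format, of "(a, b)"]
  obtain V F where V: "open V" "(a, b) \<in> V" and F: "finite F" "\<forall>f\<in>F. holomorphic2_on f V"
    and SV: "S \<inter> V = {x \<in> V. \<forall>f\<in>F. f x = 0}"
    by blast
  obtain A1 B1 where AB: "open A1" "open B1" "(a, b) \<in> A1 \<times> B1" "A1 \<times> B1 \<subseteq> V"
    using open_prod_elim[OF V] by metis
  obtain r1 where r1: "r1 > 0" "ball a r1 \<subseteq> A1 \<inter> A"
    using AB A openE[of "A1 \<inter> A" a] by (metis IntI SigmaD1 open_Int)
  obtain r2 where r2: "r2 > 0" "ball b r2 \<subseteq> B1"
    using AB openE[of B1 b] by blast
  \<comment> \<open>Within distance \<open>r3\<close> of \<open>a\<close>, the fibre over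
    \<open>b\<close> consists of \<open>a\<close> alone.\<close>
  obtain r3 where r3: "r3 > 0" "\<And>z. (z, b) \<in> S \<Longrightarrow> z \<noteq> a \<Longrightarrow> r3 \<le> dist a z"
    using finite_set_avoid[OF fin, of a] by blast
  define r where "r = min r1 (min r2 r3)"
  have r: "r > 0" using r1 r2 r3 by (simp add: r_def)
  have rV: "ball a r \<times> ball b r \<subseteq> V" and rA: "ball a r \<subseteq> A"
    using r1 r2 AB(4) by (fastforce simp: r_def)+
  have fib: "z = a" if "(z, b) \<in> S" "z \<in> ball a r" for z
    using r3(2)[OF that(1)] that(2) by (force simp: r_def)
  have S_iff: "(z, w) \<in> S \<longleftrightarrow> (\<forall>f\<in>F. f (z, w) = 0)" if "z \<in> ball a r" "w \<in> ball b r" for z w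
    using SV rV that by blast
  \<comment> \<open>Any point of the slice other than \<open>a\<close> would do: it lies outside
    \<open>S\<close>, so some local equation \<open>f\<close> is nonzero there and does not vanish
    identically on the slice.\<close>
  define z1 where "z1 = a + of_real (r / 2)"
  have z1: "z1 \<in> ball a r" "z1 \<noteq> a" using r by (auto simp: z1_def dist_norm)
  have br: "b \<in> ball b r" and ar: "a \<in> ball a r" using r by auto
  from fib z1 have "(z1, b) \<notin> S" by blast
  then obtain f where f: "f \<in> F" "f (z1, b) \<noteq> 0" using S_iff[OF z1(1) br] by blast
  have sep: "separately_holomorphic_on (\<lambda>z w. g (z, w)) (ball a r) (ball b r)" if "g \<in> F" for g
    using separately_holomorphic_on_holomorphic2[OF F(2)[rule_format, OF that] rV] .
  have "(\<lambda>z. f (z, b)) holomorphic_on ball a r"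
    using sep[OF f(1)] br by (auto simp: separately_holomorphic_on_def)
  moreover have "f (a, b) = 0" using S_iff[OF ar br] ab f(1) by blast
  ultimately obtain s where s: "s > 0" "ball a s \<subseteq> ball a r" "\<And>z. z \<in> ball a s - {a} \<Longrightarrow> f (z, b) \<noteq> 0"
    using isolated_zeros[of "\<lambda>z. f (z, b)", OF _ open_ball connected_ball ar _ z1(1)] f(2) by metis
  define \<rho> where "\<rho> = min s r / 2"
  have \<rho>: "0 < \<rho>" "\<rho> < r" "\<rho> < s" using s(1) r by (auto simp: \<rho>_def)
  have "f (z, b) \<noteq> 0" if "z \<in> sphere a \<rho>" for z
    using that \<rho> by (intro s(3)) auto
  then obtain \<delta> where \<delta>: "0 < \<delta>" "\<delta> \<le> r"
      "\<And>z w. z \<in> sphere a \<rho> \<Longrightarrow> w \<in> ball b \<delta> \<Longrightarrow> f (z, w) \<noteq> 0"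
    using nonzero_on_sphere_nearby[OF sep[OF f(1)] \<rho>(2) r] by metis
  define G where "G = (\<lambda>g z w. g (z, w)) ` F"
  have sep': "separately_holomorphic_on g (ball a r) (ball b \<delta>)" if "g \<in> G" for g
    using that sep by (auto simp: G_def intro: separately_holomorphic_on_subset[OF _ order_refl subset_ball[OF \<delta>(2)]])
  have fG: "(\<lambda>z w. f (z, w)) \<in> G" using f(1) by (auto simp: G_def)
  define E where "E = {w. \<exists>z\<in>ball a \<rho>. f (z, w) = 0 \<and> (\<forall>g\<in>G. g z w = 0)}"
  have E_iff: "w \<in> E \<longleftrightarrow> (\<exists>z\<in>ball a \<rho>. (z, w) \<in> S)" if "w \<in> ball b r" for w
  proof -
    have "(z, w) \<in> S \<longleftrightarrow> f (z, w) = 0 \<and> (\<forall>g\<in>G. g z w = 0)" if "z \<in> ball a \<rho>" for z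
      using S_iff[of z w] that \<rho>(2) \<open>w \<in> ball b r\<close> f(1) by (auto simp: G_def)
    then show ?thesis by (auto simp: E_def)
  qed
  have "b islimpt E"
    unfolding islimpt_approachable
  \<comment> \<open>A point of \<open>S\<close> near \<open>(a, b)\<close> but different from it
    cannot lie over \<open>b\<close>, because there the fibre reduces to \<open>a\<close>; its
    second coordinate is thus a point of \<open>E\<close> other than \<open>b\<close>.\<close>
  proof (intro allI impI)
    fix e :: real assume "e > 0"
    then have "min e \<rho> > 0" using \<rho> by simp
    then obtain q where q: "q \<in> S" "q \<noteq> (a, b)" "dist q (a, b) < min e \<rho>"
      using lim unfolding islimpt_approachable by blast
    obtain z w where zw: "q = (z, w)" by (cases q)
    have d: "dist z a < min e \<rho>" "dist w b < min e \<rho>"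
      using dist_fst_le[of q "(a, b)"] dist_snd_le[of q "(a, b)"] q(3) by (auto simp: zw)
    then have mem: "z \<in> ball a \<rho>" "z \<in> ball a r" "w \<in> ball b r" using \<rho> by (auto simp: dist_commute)
    have "w \<noteq> b" using fib[of z] q zw mem by auto
    moreover have "w \<in> E" using E_iff[OF mem(3)] mem(1) q(1) zw by blast
    ultimately show "\<exists>x'\<in>E. x' \<noteq> b \<and> dist x' b < e" using d by auto
  qed
  then have limE: "b islimpt {w. \<exists>z\<in>ball a \<rho>. f (z, w) = 0 \<and> (\<forall>g\<in>G. g z w = 0)}"
    by (simp only: E_def)
  have "b \<in> ball b \<delta>" "finite G" using \<delta>(1) F(1) by (auto simp: G_def)
  then obtain \<epsilon> where \<epsilon>: "0 < \<epsilon>" "ball b \<epsilon> \<subseteq> E"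
    unfolding E_def
    using common_zeros_nearby[OF sep'[OF fG] open_ball _ \<rho>(1,2) \<delta>(3) _ sep' limE] by blast
  show thesis
  proof
    show "0 < min \<epsilon> r" using \<epsilon> r by simp
    show "ball b (min \<epsilon> r) \<subseteq> snd ` (S \<inter> A \<times> UNIV)"
    proof
      fix w assume w: "w \<in> ball b (min \<epsilon> r)"
      then have "w \<in> E" "w \<in> ball b r" using \<epsilon> by auto
      then obtain z where "z \<in> ball a \<rho>" "(z, w) \<in> S" using E_iff by blast
      moreover from this have "z \<in> A" using \<rho>(2) rA by auto
      ultimately show "w \<in> snd ` (S \<inter> A \<times> UNIV)" by force
    qed
  qed
qed

section \<open>The Riemann sphere and its subvarieties\<close>

text \<open>Shows how an open set of one chart looks in the other. Since
  \<open>inverse 0 = 0\<close> in HOL, the origin is excluded by hand.\<close>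

lemma open_inverse_preimage:
  fixes B :: "complex set"
  assumes "open B"
  shows "open {z. z \<noteq> 0 \<and> inverse z \<in> B}"
proof -
  have "continuous_on (- {0 :: complex}) inverse" by (intro continuous_intros) auto
  from continuous_open_preimage[OF this _ assms] show ?thesis
    by (simp add: open_Compl vimage_def Int_def)
qed

text \<open>Inversion exchanges complements of compact sets with neighbourhoods of \<open>0\<close>,
  so openness at infinity becomes openness at \<open>0\<close> in the second chart.\<close>

lemma openin_sphere_iff:
  "openin sphere_topology T \<longleftrightarrow> open (Some -` T) \<and> open (coord_at_infinity -` T)"
proof
  assume "openin sphere_topology T"
  then consider B where "open B" "T = Some ` B"
    | C where "compact C" "T = insert None (Some ` (- C))"
    unfolding sphere_topology_def openin_Alexandroff_compactification by (auto simp: Compl_eq_Diff_UNIV)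
  then show "open (Some -` T) \<and> open (coord_at_infinity -` T)"
  proof cases
    case 1
    have "Some -` T = B" using 1 by auto
    moreover have "coord_at_infinity -` T = {z. z \<noteq> 0 \<and> inverse z \<in> B}"
      using 1 by (auto simp: coord_at_infinity_def split: if_splits)
    ultimately show ?thesis using 1 open_inverse_preimage by simp
  next
    case 2
    obtain M where M: "M > 0" "\<And>z. z \<in> C \<Longrightarrow> norm z \<le> M"
      using compact_imp_bounded[OF 2(1)] unfolding bounded_pos by blast
    \<comment> \<open>A whole disc around \<open>0\<close> lands outside \<open>C\<close>, which
      settles the one point that inversion does not reach.\<close>
    have "inverse z \<notin> C" if "z \<noteq> 0" "norm z < inverse M" for z
    proof
      assume "inverse z \<in> C"
      then have "inverse (norm z) \<le> M" using M(2) by (metis norm_inverse)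
      moreover have "M < inverse (norm z)"
        using that M(1) less_imp_inverse_less[of "norm z" "inverse M"] by simp
      ultimately show False by simp
    qed
    then have "coord_at_infinity -` T = ball 0 (inverse M) \<union> {z. z \<noteq> 0 \<and> inverse z \<in> - C}"
      using 2 M(1) by (auto simp: coord_at_infinity_def split: if_splits)
    moreover have "Some -` T = - C" using 2 by auto
    moreover have "open (- C)" using 2 compact_imp_closed by auto
    ultimately show ?thesis using open_inverse_preimage[of "- C"] by (metis open_Un open_ball)
  qed
next
  assume T: "open (Some -` T) \<and> open (coord_at_infinity -` T)"
  show "openin sphere_topology T"
  proof (cases "None \<in> T")
    case False
    then have "T = Some ` (Some -` T)" by (auto simp: image_iff) (metis not_None_eq)
    with T show ?thesis
      unfolding sphere_topology_def openin_Alexandroff_compactification by auto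
  next
    case True
    define C where "C = - (Some -` T)"
    have "0 \<in> coord_at_infinity -` T" using True by (simp add: coord_at_infinity_def)
    then obtain e where e: "e > 0" "ball 0 e \<subseteq> coord_at_infinity -` T" using T openE by blast
    \<comment> \<open>The disc of radius \<open>e\<close> around infinity lies in \<open>T\<close>,
      which bounds the complement.\<close>
    have "norm z \<le> inverse e" if "z \<in> C" for z
    proof (rule ccontr)
      assume "\<not> norm z \<le> inverse e"
      then have ie: "inverse e < norm z" by simp
      then have "z \<noteq> 0" using e(1) by auto
      have "norm (inverse z) < e"
        using less_imp_inverse_less[OF ie] e(1) by (simp add: norm_inverse)
      then have "coord_at_infinity (inverse z) \<in> T" using e(2) by auto
      then show False using \<open>z \<noteq> 0\<close> that by (simp add: coord_at_infinity_def C_def)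
    qed
    then have "bounded C" by (auto simp: bounded_iff)
    moreover have "closed C" using T by (simp add: C_def closed_Compl)
    ultimately have "compact C" by (simp add: compact_eq_bounded_closed)
    moreover have "T = insert None (Some ` (UNIV - C))"
      using True by (force simp: C_def image_iff split: option.split)
    ultimately show ?thesis
      unfolding sphere_topology_def openin_Alexandroff_compactification
      using \<open>closed C\<close> by auto
  qed
qed

section \<open>The two parametrizations as open embeddings covering the sphere\<close>

lemma inj_sphere_param:
  assumes "\<phi> \<in> sphere_params"
  shows "inj \<phi>"
  using assms by (auto simp: sphere_params_def coord_at_infinity_def inj_def split: if_splits)

lemma open_sphere_param_vimage:
  assumes "\<phi> \<in> sphere_params" "openin sphere_topology T"
  shows "open (\<phi> -` T)"
  using assms by (auto simp: sphere_params_def openin_sphere_iff)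

lemma openin_sphere_param_image:
  assumes "\<phi> \<in> sphere_params" "open B"
  shows "openin sphere_topology (\<phi> ` B)"
proof -
  have same: "\<phi> -` \<phi> ` B = B" using inj_sphere_param[OF assms(1)] by (rule inj_vimage_image_eq)
  have "coord_at_infinity -` Some ` B = {z. z \<noteq> 0 \<and> inverse z \<in> B}"
    by (auto simp: coord_at_infinity_def split: if_splits)
  moreover have "Some -` coord_at_infinity ` B = {z. z \<noteq> 0 \<and> inverse z \<in> B}"
  proof -
    have "Some z \<in> coord_at_infinity ` B \<longleftrightarrow> z \<noteq> 0 \<and> inverse z \<in> B" for z
    proof
      assume "z \<noteq> 0 \<and> inverse z \<in> B"
      moreover from this have "Some z = coord_at_infinity (inverse z)" by (simp add: coord_at_infinity_def)
      ultimately show "Some z \<in> coord_at_infinity ` B" by blast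
    qed (auto simp: coord_at_infinity_def split: if_splits)
    then show ?thesis by auto
  qed
  moreover have "\<phi> = Some \<or> \<phi> = coord_at_infinity" using assms(1) by (simp add: sphere_params_def)
  ultimately show ?thesis
    using same assms(2) open_inverse_preimage[OF assms(2)] unfolding openin_sphere_iff
    by (elim disjE) simp_all
qed

lemma sphere_paramE:
  obtains \<phi> z where "\<phi> \<in> sphere_params" "x = \<phi> z"
proof (cases x)
  case None
  then have "x = coord_at_infinity 0" by (simp add: coord_at_infinity_def)
  then show ?thesis using that by (auto simp: sphere_params_def)
next
  case (Some z)
  then show ?thesis using that by (auto simp: sphere_params_def)
qed

text \<open>The source of explicit equations: the constant \<open>1\<close> cuts out the empty set,
  and two shifted coordinates cut out a point.\<close>

lemma holomorphic2_on_affine: "holomorphic2_on (\<lambda>x. \<alpha> * fst x + \<beta> * snd x + c) V"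
  unfolding holomorphic2_on_def
  by (intro ballI exI[of _ \<alpha>] exI[of _ \<beta>]) (auto intro!: derivative_eq_intros simp: split_beta)

lemma analytic_subset_C2_empty: "analytic_subset_C2 {}"
  unfolding analytic_subset_C2_def
  by (intro allI exI[of _ UNIV] exI[of _ "{\<lambda>x. 0 * fst x + 0 * snd x + 1}"])
    (simp add: holomorphic2_on_affine[of 0 0 1, simplified])

lemma analytic_subset_C2_singleton: "analytic_subset_C2 {(a, b)}"
  unfolding analytic_subset_C2_def
proof (intro allI exI conjI)
  show "\<forall>f\<in>{\<lambda>x. 1 * fst x + 0 * snd x + (- a), \<lambda>x. 0 * fst x + 1 * snd x + (- b)}. holomorphic2_on f UNIV"
    by (intro ballI) (auto intro: holomorphic2_on_affine[of 1 0 "- a", simplified]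
        holomorphic2_on_affine[of 0 1 "- b", simplified])
qed auto

lemma vimage_singleton_cases:
  assumes "inj f"
  obtains "f -` {y} = {}" | x where "f -` {y} = {x}" "f x = y"
proof (cases "y \<in> range f")
  case True
  then obtain x where "f x = y" by blast
  then show ?thesis using that(2)[of x] assms by (auto simp: inj_def)
next
  case False
  then show ?thesis using that(1) by blast
qed

lemma subvariety_singleton: "subvariety {p}"
  unfolding subvariety_def
proof (intro ballI)
  fix \<phi> \<psi> assume "\<phi> \<in> sphere_params" "\<psi> \<in> sphere_params"
  then have "inj (map_prod \<phi> \<psi>)" by (intro prod.inj_map inj_sphere_param)
  then show "analytic_subset_C2 (map_prod \<phi> \<psi> -` {p})"
    by (rule vimage_singleton_cases[where y = p])
      (auto simp: analytic_subset_C2_empty intro: analytic_subset_C2_singleton)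
qed

lemma subvariety_remove_isolated:
  assumes A: "subvariety A" and O: "openin sphere_topology O1" "openin sphere_topology O2"
    and isolated: "A \<inter> O1 \<times> O2 = {p}"
  shows "subvariety (A - {p})"
  unfolding subvariety_def
proof (intro ballI)
  fix \<phi> \<psi> assume par: "\<phi> \<in> sphere_params" "\<psi> \<in> sphere_params"
  define m where "m = map_prod \<phi> \<psi>"
  have inj: "inj m" using par unfolding m_def by (intro prod.inj_map inj_sphere_param)
  have "closed (m -` {p})"
    by (rule vimage_singleton_cases[OF inj, of p]) auto
  have "analytic_subset_C2 (m -` A)" using A par by (simp add: subvariety_def m_def)
  show "analytic_subset_C2 (map_prod \<phi> \<psi> -` (A - {p}))"
    unfolding analytic_subset_C2_def m_def[symmetric]
  proof
    fix q
    show "\<exists>V F. open V \<and> q \<in> V \<and> finite F \<and> (\<forall>f\<in>F. holomorphic2_on f V) \<and>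
            m -` (A - {p}) \<inter> V = {x \<in> V. \<forall>f\<in>F. f x = 0}"
    proof (cases "m q = p")
      case True
      define V where "V = (\<phi> -` O1) \<times> (\<psi> -` O2)"
      have "open V" unfolding V_def using par O by (intro open_Times open_sphere_param_vimage)
      moreover have "q \<in> V" using True isolated by (cases q) (auto simp: V_def m_def)
      moreover have "m -` (A - {p}) \<inter> V = {}"
        using isolated by (force simp: V_def m_def)
      ultimately show ?thesis
        by (intro exI[of _ V] exI[of _ "{\<lambda>x. 0 * fst x + 0 * snd x + 1}"])
          (simp add: holomorphic2_on_affine[of 0 0 1, simplified])
    next
      case False
      obtain V F where V: "open V" "q \<in> V" "finite F" "\<forall>f\<in>F. holomorphic2_on f V"
        "m -` A \<inter> V = {x \<in> V. \<forall>f\<in>F. f x = 0}"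
        using \<open>analytic_subset_C2 (m -` A)\<close>[unfolded analytic_subset_C2_def, rule_format, of q] by blast
      have "open (V - m -` {p})" using V(1) \<open>closed (m -` {p})\<close> by (rule open_Diff)
      moreover have "q \<in> V - m -` {p}" using False V by auto
      moreover have "\<forall>f\<in>F. holomorphic2_on f (V - m -` {p})"
        using V(4) by (auto simp: holomorphic2_on_def)
      moreover have "m -` (A - {p}) \<inter> (V - m -` {p}) = {x \<in> V - m -` {p}. \<forall>f\<in>F. f x = 0}"
        using V(5) by blast
      ultimately show ?thesis using V(3) by blast
    qed
  qed
qed

text \<open>An isolated point would split off: \<open>{p}\<close> and \<open>A - {p}\<close> are
  both subvarieties, and irreducibility forces one of them to be all of \<open>A\<close>.\<close>

lemma irreducible_subvariety_isolated_point:
  assumes A: "irreducible_subvariety A"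
    and O: "openin sphere_topology O1" "openin sphere_topology O2"
    and isolated: "A \<inter> O1 \<times> O2 = {p}"
  shows "A = {p}"
proof -
  have "subvariety (A - {p})"
    using A O isolated subvariety_remove_isolated unfolding irreducible_subvariety_def by blast
  moreover have "A = {p} \<union> (A - {p})" using isolated by blast
  ultimately have "A = {p} \<or> A = A - {p}"
    using A subvariety_singleton unfolding irreducible_subvariety_def by blast
  then show ?thesis using isolated by blast
qed

section \<open>Correspondences\<close>

text \<open>If \<open>(a, b)\<close> were isolated in the chart, the chart images of a small box
  would isolate its image in \<open>\<Gamma>\<close>, which would then be a single point.\<close>

lemma analytic_chart_islimpt:
  assumes \<Gamma>: "irreducible_subvariety \<Gamma>" "\<Gamma> \<noteq> {(\<phi> a, \<psi> b)}"
    and par: "\<phi> \<in> sphere_params" "\<psi> \<in> sphere_params" and mem: "(\<phi> a, \<psi> b) \<in> \<Gamma>"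
  shows "(a, b) islimpt map_prod \<phi> \<psi> -` \<Gamma>"
proof (rule ccontr)
  assume "\<not> (a, b) islimpt map_prod \<phi> \<psi> -` \<Gamma>"
  then obtain T where T: "open T" "(a, b) \<in> T" "\<And>q. q \<in> T \<Longrightarrow> map_prod \<phi> \<psi> q \<in> \<Gamma> \<Longrightarrow> q = (a, b)"
    unfolding islimpt_def by blast
  obtain A B where AB: "open A" "open B" "(a, b) \<in> A \<times> B" "A \<times> B \<subseteq> T"
    using open_prod_elim[OF T(1,2)] by metis
  have "\<Gamma> \<inter> \<phi> ` A \<times> \<psi> ` B = {(\<phi> a, \<psi> b)}"
  proof (intro equalityI subsetI)
    fix q assume q: "q \<in> \<Gamma> \<inter> \<phi> ` A \<times> \<psi> ` B"
    then obtain z w where zw: "z \<in> A" "w \<in> B" "q = (\<phi> z, \<psi> w)" by blast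
    then have "(z, w) = (a, b)" using q AB(4) by (intro T(3)) auto
    then show "q \<in> {(\<phi> a, \<psi> b)}" using zw by simp
  qed (use mem AB(3) in auto)
  then have "\<Gamma> = {(\<phi> a, \<psi> b)}"
    by (rule irreducible_subvariety_isolated_point[OF \<Gamma>(1) openin_sphere_param_image[OF par(1) AB(1)]
          openin_sphere_param_image[OF par(2) AB(2)]])
  with \<Gamma>(2) show False ..
qed

theorem theorem4p2:
  fixes N :: nat
    and \<Gamma> :: "nat \<Rightarrow> (riemann_sphere \<times> riemann_sphere) set"
    and U :: "riemann_sphere set"
  assumes "holomorphic_correspondence N \<Gamma>"
    and "openin sphere_topology U"
  shows "openin sphere_topology (correspondence_image N \<Gamma> U)"
\<comment> \<open>It suffices to surround each image point \<open>y\<close> by an open subset of the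
  image, found in charts around \<open>y\<close> and around a preimage \<open>x\<close>.\<close>
proof (subst openin_subopen, intro ballI)
  fix y assume "y \<in> correspondence_image N \<Gamma> U"
  then obtain x j where j: "j \<in> {1..N}" and xy: "(x, y) \<in> \<Gamma> j" "x \<in> U"
    unfolding correspondence_image_def by force
  have irr: "irreducible_subvariety (\<Gamma> j)" and surj: "fst ` \<Gamma> j = UNIV"
    and fin: "finite (SIGMA j:{1..N}. snd -` {y} \<inter> \<Gamma> j)"
    using assms(1) j unfolding holomorphic_correspondence_def by blast+
  obtain \<phi> a where \<phi>: "\<phi> \<in> sphere_params" "x = \<phi> a" by (rule sphere_paramE)
  obtain \<psi> b where \<psi>: "\<psi> \<in> sphere_params" "y = \<psi> b" by (rule sphere_paramE)
  define S where "S = map_prod \<phi> \<psi> -` \<Gamma> j"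
  have S: "analytic_subset_C2 S"
    using irr \<phi> \<psi> unfolding irreducible_subvariety_def subvariety_def S_def by blast
  have ab: "(a, b) \<in> S" using xy \<phi> \<psi> by (simp add: S_def)
  \<comment> \<open>A single point cannot project onto the whole sphere.\<close>
  have "\<Gamma> j \<noteq> {(\<phi> a, \<psi> b)}"
  proof
    assume "\<Gamma> j = {(\<phi> a, \<psi> b)}"
    then have "UNIV = {\<phi> a}" using surj by simp
    then have "None = \<phi> a" "Some 0 = \<phi> a" by blast+
    then show False by simp
  qed
  then have lim: "(a, b) islimpt S"
    using analytic_chart_islimpt[OF irr _ \<phi>(1) \<psi>(1)] xy \<phi> \<psi> by (simp add: S_def)
  \<comment> \<open>The chart fibre over \<open>b\<close> embeds by an injective map into the
    disjoint union of the fibres over \<open>y\<close>, which is finite.\<close>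
  have "finite ((\<lambda>z. (j, \<phi> z, y)) -` (SIGMA j:{1..N}. snd -` {y} \<inter> \<Gamma> j))"
    using inj_sphere_param[OF \<phi>(1)] by (intro finite_vimageI[OF fin]) (auto simp: inj_def)
  then have "finite {z. (z, b) \<in> S}"
    by (rule rev_finite_subset) (use j \<psi> in \<open>auto simp: S_def\<close>)
  moreover have "open (\<phi> -` U)" "a \<in> \<phi> -` U"
    using open_sphere_param_vimage[OF \<phi>(1) assms(2)] xy \<phi> by auto
  ultimately obtain \<epsilon> where \<epsilon>: "0 < \<epsilon>" "ball b \<epsilon> \<subseteq> snd ` (S \<inter> (\<phi> -` U) \<times> UNIV)"
    using analytic_subset_snd_image_neighbourhood[OF S ab _ lim] by metis
  have "\<psi> ` ball b \<epsilon> \<subseteq> correspondence_image N \<Gamma> U"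
  proof
    fix v assume "v \<in> \<psi> ` ball b \<epsilon>"
    then obtain w where w: "w \<in> ball b \<epsilon>" "v = \<psi> w" by blast
    then obtain z where "(z, w) \<in> S" "\<phi> z \<in> U" using \<epsilon>(2) by auto
    then show "v \<in> correspondence_image N \<Gamma> U"
      using j w unfolding correspondence_image_def S_def by force
  qed
  moreover have "y \<in> \<psi> ` ball b \<epsilon>" using \<psi> \<epsilon> by simp
  ultimately show "\<exists>T. openin sphere_topology T \<and> y \<in> T \<and> T \<subseteq> correspondence_image N \<Gamma> U"
    using openin_sphere_param_image[OF \<psi>(1) open_ball] by blast
qed

end
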